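(* Let $\delta$ be a positive integer. Let $(T_n(x))_{n\ge\delta-1}$ be the polynomials defined by $T_{\delta-1}(x)=1$ and, for $n\ge\delta-1$, $$T_{n+1}(x)=\Bigl(\tfrac{n-\delta+1}{\delta}x^2+x+1+\tfrac{n-\delta+1}{\delta}\Bigr)T_n(x)+\tfrac1\delta\bigl(-x^3+x^2-x+1\bigr)\frac{d}{dx}T_n(x)$$ (so $\deg T_n(x)=n-\delta+1$). Then $T_n(x)$ is unimodal for every $n\ge\delta+2$.
   Context: A polynomial $f(x)=\sum_{k=0}^d f_kx^k$ is unimodal if there is $m$ with $f_0\le f_1\le\cdots\le f_m\ge\cdots\ge f_{d-1}\ge f_d$. *)

theory Defs
  imports "HOL-Computational_Algebra.Polynomial"
begin

definition unimodal :: "'a::linordered_idom poly \<Rightarrow> bool" where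
  "unimodal f \<longleftrightarrow> (\<exists>m\<le>degree f.
     (\<forall>k<m. coeff f k \<le> coeff f (Suc k)) \<and>
     (\<forall>k. m \<le> k \<and> k < degree f \<longrightarrow> coeff f (Suc k) \<le> coeff f k))"

end

(* The idea: with N = n + 1 - \<delta>, the coefficients of T n are palindromic, and their consecutive
   differences d N k satisfy a four-term recurrence whose weights are all nonnegative.  So
   nonnegativity of the differences in the lower half propagates from N to N + 1, except possibly
   at the middle index k of an odd N = 2 k - 1, where antisymmetry turns the recurrence into
   \<delta> d (N + 1) k = (\<delta> - 2) d N (k - 1) + (k + 2) d N (k - 2).
   This is a problem only for \<delta> = 1, and there the missing inequality
   d N (k - 1) \<le> (k + 2) d N (k - 2) follows from nonnegativity of the differences at the even
   level N - 1.  The induction starts at N = 3; for \<delta> = 1 the level N = 2 is not unimodal. *)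

theory Submission
  imports Defs
begin

(* Integer indices make the recurrence and the symmetry hold without boundary cases. *)
locale palindromic_recurrence =
  fixes \<delta> :: nat and a :: "nat \<Rightarrow> int \<Rightarrow> real"
  assumes delta_pos: "\<delta> > 0"
    and init: "a 0 k = (if k = 0 then 1 else 0)"
    and neg: "k < 0 \<Longrightarrow> a N k = 0"
    and rec: "real \<delta> * a (Suc N) k =
      (real N - k + 2) * a N (k - 2) + (real \<delta> + k - 1) * a N (k - 1)
      + (real \<delta> + real N - k) * a N k + (k + 1) * a N (k + 1)"
begin

section \<open>Symmetry and positivity of the coefficients\<close>

lemma delta_mult_nonneg_iff: "real \<delta> * x \<ge> 0 \<longleftrightarrow> x \<ge> 0"
  using delta_pos by (simp add: zero_le_mult_iff)

text \<open>Replacing k by N + 1 - k in \<open>rec\<close> swaps the two outer terms and the two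
  inner terms, weights included, so the symmetry passes from N to N + 1.\<close>

lemma sym: "a N (int N - k) = a N k"
proof (induction N arbitrary: k)
  case 0
  then show ?case by (simp add: init)
next
  case (Suc N)
  have s: "a N (int N + 1 - k - 2) = a N (k + 1)" "a N (int N + 1 - k - 1) = a N k"
    "a N (int N + 1 - k) = a N (k - 1)" "a N (int N + 1 - k + 1) = a N (k - 2)"
    using Suc[of "k + 1"] Suc[of k] Suc[of "k - 1"] Suc[of "k - 2"] by (simp_all add: algebra_simps)
  have "real \<delta> * a (Suc N) (int N + 1 - k) = real \<delta> * a (Suc N) k"
    unfolding rec s by (simp add: algebra_simps)
  then show ?case using delta_pos by (simp add: add.commute)
qed

lemma above: "k > int N \<Longrightarrow> a N k = 0"
  using sym[of N k] neg[of "int N - k" N] by simp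

lemma nonneg: "a N k \<ge> 0"
proof (induction N arbitrary: k)
  case 0
  then show ?case by (simp add: init)
next
  case (Suc N)
  show ?case
  proof (cases "0 \<le> k \<and> k \<le> int N + 1")
    case True
    have w: "0 \<le> real N - k + 2" "0 \<le> real \<delta> + k - 1" "0 \<le> real \<delta> + real N - k"
      "0 \<le> real_of_int k + 1"
      using True delta_pos by linarith+
    have "real \<delta> * a (Suc N) k \<ge> 0"
      unfolding rec by (rule w Suc add_nonneg_nonneg mult_nonneg_nonneg)+
    then show ?thesis by (simp only: delta_mult_nonneg_iff)
  next
    case False
    then show ?thesis using neg[of k "Suc N"] above[of "Suc N" k] by fastforce
  qed
qed

lemma zero_pos: "a N 0 > 0"
proof (induction N)
  case 0
  then show ?case by (simp add: init)
next
  case (Suc N)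
  have "real \<delta> * a (Suc N) 0 = (real \<delta> + real N) * a N 0 + a N 1"
    using rec[of N 0] by (simp add: neg)
  also have "\<dots> > 0" using Suc delta_pos nonneg[of N 1] by (simp add: add_pos_nonneg)
  finally show ?case by (simp add: zero_less_mult_iff)
qed

section \<open>Consecutive differences and their sign in the lower half\<close>

definition d :: "nat \<Rightarrow> int \<Rightarrow> real" where
  "d N k = a N k - a N (k - 1)"

lemma d_neg: "k < 0 \<Longrightarrow> d N k = 0"
  by (simp add: d_def neg)

lemma d_antisym: "d N (int N + 1 - k) = - d N k"
  using sym[of N k] sym[of N "k - 1"] by (simp add: d_def algebra_simps)

text \<open>The four weights in \<open>rec\<close> add up to 2 \<delta> + 2 N + 2, independently of
  k, so subtracting the recurrence at k - 1 leaves only differences.\<close>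

lemma d_rec: "real \<delta> * d (Suc N) k =
    (k + 1) * d N (k + 1) + (real \<delta> + real N + 1 - k) * d N k
    + (real \<delta> + k - 1) * d N (k - 1) + (real N - k + 3) * d N (k - 2)"
proof -
  have "real \<delta> * d (Suc N) k = real \<delta> * a (Suc N) k - real \<delta> * a (Suc N) (k - 1)"
    by (simp add: d_def algebra_simps)
  then show ?thesis unfolding rec d_def by (simp add: algebra_simps)
qed

definition lower_increasing :: "nat \<Rightarrow> bool" where
  "lower_increasing N \<longleftrightarrow> (\<forall>k. 2 * k \<le> int N + 1 \<longrightarrow> d N k \<ge> 0)"

text \<open>Vacuous for even N; for odd N it is exactly what the middle case of
  \<open>lower_increasing_Suc\<close> needs when \<delta> = 1.\<close>

definition middle_bound :: "nat \<Rightarrow> bool" where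
  "middle_bound N \<longleftrightarrow> (\<forall>k. 2 * k = int N + 1 \<longrightarrow> d N (k - 1) \<le> (real_of_int k + 2) * d N (k - 2))"

lemma lower_increasing_Suc:
  assumes inc: "lower_increasing N" and mid: "\<delta> = 1 \<Longrightarrow> middle_bound N"
  shows "lower_increasing (Suc N)"
  unfolding lower_increasing_def
proof (intro allI impI)
  fix k :: int
  assume k2: "2 * k \<le> int (Suc N) + 1"
  have d0: "d N j \<ge> 0" if "2 * j \<le> int N + 1" for j
    using inc that by (simp add: lower_increasing_def)
  have del: "real \<delta> \<ge> 1" using delta_pos by simp
  show "d (Suc N) k \<ge> 0"
  proof (cases "k < 0")
    case True
    then show ?thesis by (simp add: d_neg)
  next
    case False
    then have k: "0 \<le> real_of_int k" "2 * real_of_int k \<le> real N + 2" using k2 by linarith+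
    \<comment> \<open>Only in the first case does k + 1 stay in the range of the hypothesis. In the
      next two, antisymmetry folds \<open>d N (k + 1)\<close> back; in the last, k is the fixed
      point of the reflection at level N + 1.\<close>
    consider "2 * k + 1 \<le> int N" | "2 * k = int N" | "2 * k = int N + 1" | "2 * k = int N + 2"
      using k2 by linarith
    then show ?thesis
    proof cases
      case 1
      then have "real \<delta> * d (Suc N) k \<ge> 0"
        unfolding d_rec using k del
        by (intro add_nonneg_nonneg mult_nonneg_nonneg d0) auto
      then show ?thesis by (simp only: delta_mult_nonneg_iff)
    next
      case 2
      then have N: "real N = 2 * real_of_int k" by linarith
      \<comment> \<open>The folded term lowers the weight of \<open>d N k\<close> from \<delta> + k
        + 1 to \<delta>, which is still positive.\<close>
      have "d N (k + 1) = - d N k" using d_antisym[of N k] 2[symmetric] by (simp add: algebra_simps)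
      then have "real \<delta> * d (Suc N) k =
          real \<delta> * d N k + (real \<delta> + k - 1) * d N (k - 1) + (k + 3) * d N (k - 2)"
        unfolding d_rec N by (simp add: algebra_simps)
      also have "\<dots> \<ge> 0"
        using k del 2 by (intro add_nonneg_nonneg mult_nonneg_nonneg d0) auto
      finally show ?thesis by (simp only: delta_mult_nonneg_iff)
    next
      case 3
      then have N: "real N = 2 * real_of_int k - 1" by linarith
      have "d N k = 0" using d_antisym[of N k] 3[symmetric] by simp
      moreover have "d N (k + 1) = - d N (k - 1)"
        using d_antisym[of N "k - 1"] 3[symmetric] by simp
      ultimately have "real \<delta> * d (Suc N) k =
          (real \<delta> - 2) * d N (k - 1) + (k + 2) * d N (k - 2)"
        unfolding d_rec N by (simp add: algebra_simps)
      also have "\<dots> \<ge> 0"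
      proof (cases "\<delta> = 1")
        case True
        then show ?thesis using mid 3 by (simp add: middle_bound_def)
      next
        case False
        then have "real \<delta> \<ge> 2" using delta_pos by simp
        then show ?thesis
          using k 3 by (intro add_nonneg_nonneg mult_nonneg_nonneg d0) auto
      qed
      finally show ?thesis by (simp only: delta_mult_nonneg_iff)
    next
      case 4
      then have "int (Suc N) + 1 - k = k" by simp
      then show ?thesis using d_antisym[of "Suc N" k] by simp
    qed
  qed
qed

text \<open>Only even N = 2 k matters. Expanding both differences by \<open>d_rec\<close> at level N
  makes the gap between the two sides a combination of lower-half differences with nonnegative
  weights.\<close>

lemma middle_bound_Suc:
  assumes inc: "lower_increasing N" and "\<delta> = 1" and "N \<ge> 3"
  shows "middle_bound (Suc N)"
  unfolding middle_bound_def
proof (intro allI impI)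
  fix l :: int
  assume l: "2 * l = int (Suc N) + 1"
  define k where "k = l - 1"
  \<comment> \<open>Evenness and N \<ge> 3 give k \<ge> 2, which keeps the weight (k + 3) (k - 2) of
    \<open>d N (k - 2)\<close> nonnegative.\<close>
  have N: "2 * k = int N" and k2: "k \<ge> 2" using l \<open>N \<ge> 3\<close> unfolding k_def by auto
  have N': "real N = 2 * real_of_int k" using N by linarith
  have k2': "real_of_int k \<ge> 2" using k2 by linarith
  have d0: "d N j \<ge> 0" if "j \<le> k" for j
    using inc that N by (simp add: lower_increasing_def)
  have dk: "d N (k + 1) = - d N k" using d_antisym[of N k] N[symmetric] by simp
  have e1: "d (Suc N) k = d N k + k * d N (k - 1) + (k + 3) * d N (k - 2)"
    using d_rec[of N k] unfolding N' dk by (simp add: \<open>\<delta> = 1\<close> algebra_simps)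
  have e2: "d (Suc N) (k - 1) = k * d N k + (k + 3) * d N (k - 1) + (k - 1) * d N (k - 2)
      + (k + 4) * d N (k - 3)"
    using d_rec[of N "k - 1"] unfolding N' by (simp add: \<open>\<delta> = 1\<close> algebra_simps)
  have "(k + 3) * d (Suc N) (k - 1) - d (Suc N) k =
      (real_of_int k * (k + 3) - 1) * d N k + ((real_of_int k + 3) * (k + 3) - k) * d N (k - 1)
      + (real_of_int k + 3) * (k - 2) * d N (k - 2) + (real_of_int k + 3) * (k + 4) * d N (k - 3)"
    unfolding e1 e2 by (simp add: algebra_simps)
  also have "\<dots> \<ge> 0"
  proof -
    have "real_of_int k * (real_of_int k + 3) \<ge> 1 * 1"
      "(real_of_int k + 3) * (real_of_int k + 3) \<ge> real_of_int k * 1"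
      using k2' by (intro mult_mono; simp)+
    then show ?thesis
      using k2' by (intro add_nonneg_nonneg mult_nonneg_nonneg d0) auto
  qed
  finally show "d (Suc N) (l - 1) \<le> (real_of_int l + 2) * d (Suc N) (l - 2)"
    by (simp add: k_def add.commute)
qed

lemma base: "lower_increasing 3" "\<delta> = 1 \<Longrightarrow> middle_bound 3"
proof -
  have del: "real \<delta> > 0" using delta_pos by simp
  have a1: "a 1 k = (if k = 0 \<or> k = 1 then 1 else 0)" for k
    using rec[of 0 k] del by (cases "k = -1") (auto simp: init neg split: if_splits)
  have a2: "a 2 0 = (real \<delta> + 2) / \<delta>" "a 2 1 = 2" "a 2 2 = (real \<delta> + 2) / \<delta>"
    using rec[of 1 0] rec[of 1 1] rec[of 1 2] del
    by (simp_all add: a1[simplified] numeral_2_eq_2[symmetric] field_simps)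
  have a3: "real \<delta> * a 3 0 = (real \<delta> + 2) * a 2 0 + 2"
    "real \<delta> * a 3 1 = real \<delta> * a 2 0 + (real \<delta> + 1) * 2 + 2 * a 2 2"
    using rec[of 2 0] rec[of 2 1] by (simp_all add: a2(2) neg numeral_3_eq_3[symmetric])
  \<comment> \<open>As \<open>a 2 0\<close> and \<open>a 2 2\<close> agree, all multiples of them
    cancel and the difference is 2 for every \<delta>.\<close>
  have "real \<delta> * (a 3 1 - a 3 0) = real \<delta> * 2"
    using a3 del by (simp add: a2 algebra_simps add_divide_distrib)
  then have d1: "d 3 1 = 2" using del by (simp add: d_def)
  have d0: "d 3 0 = a 3 0" by (simp add: d_def neg)
  have d2: "d 3 2 = 0" using d_antisym[of 3 2] by simp
  show "lower_increasing 3"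
    unfolding lower_increasing_def
  proof (intro allI impI)
    fix k :: int
    assume "2 * k \<le> int 3 + 1"
    then consider "k < 0" | "k = 0" | "k = 1" | "k = 2" by force
    then show "d 3 k \<ge> 0"
      by cases (simp_all add: d_neg d0 d1 d2 nonneg)
  qed
  show "middle_bound 3" if "\<delta> = 1"
    unfolding middle_bound_def
  proof (intro allI impI)
    fix k :: int
    assume "2 * k = int 3 + 1"
    then have "k = 2" by simp
    then show "d 3 (k - 1) \<le> (real_of_int k + 2) * d 3 (k - 2)"
      using a3(1) that by (simp add: d0 d1 a2)
  qed
qed

text \<open>For \<delta> = 1 the induction must carry \<open>middle_bound\<close> along, since the
  step for \<open>lower_increasing\<close> uses it.\<close>

lemma lower_increasing: "N \<ge> 3 \<Longrightarrow> lower_increasing N"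
proof -
  have "lower_increasing N \<and> (\<delta> = 1 \<longrightarrow> middle_bound N)" if "N \<ge> 3"
    using that
    by (induction N rule: dec_induct) (auto simp: base lower_increasing_Suc middle_bound_Suc)
  then show "N \<ge> 3 \<Longrightarrow> lower_increasing N" by simp
qed

section \<open>From coefficient sequences to polynomials\<close>

lemma degree_coeff_eq:
  assumes "\<And>k. coeff p k = a N (int k)"
  shows "degree p = N"
proof (rule antisym)
  show "degree p \<le> N" using assms above by (intro degree_le) auto
  have "coeff p N > 0" using assms[of N] sym[of N 0] zero_pos[of N] by simp
  then show "N \<le> degree p" by (intro le_degree) simp
qed

lemma unimodal_coeff_eq:
  assumes p: "\<And>k. coeff p k = a N (int k)" and N: "N \<ge> 3"
  shows "unimodal p"
proof -
  have inc: "d N k \<ge> 0" if "2 * k \<le> int N + 1" for k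
    using lower_increasing[OF N] that by (simp add: lower_increasing_def)
  have step: "coeff p (Suc k) - coeff p k = d N (int k + 1)" for k
    by (simp add: p d_def add.commute)
  show ?thesis
    unfolding unimodal_def degree_coeff_eq[OF p]
  proof (intro exI[of _ "N div 2"] conjI allI impI)
    fix k assume "k < N div 2"
    then have "2 * (k + 1) \<le> N" by presburger
    then have "2 * (int k + 1) \<le> int N + 1" by simp
    then show "coeff p k \<le> coeff p (Suc k)"
      using inc step[of k] by fastforce
  next
    fix k assume "N div 2 \<le> k \<and> k < N"
    then have "N \<le> 2 * k + 1" by presburger
    \<comment> \<open>The descent after k mirrors the ascent into N - k, which lies in the lower
      half.\<close>
    then have "d N (int N - int k) \<ge> 0" by (intro inc) simp
    then show "coeff p (Suc k) \<le> coeff p k"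
      using d_antisym[of N "int N - int k"] step[of k] by (simp add: add.commute)
  qed simp
qed

end

definition int_coeff :: "'a::zero poly \<Rightarrow> int \<Rightarrow> 'a" where
  "int_coeff p k = (if k < 0 then 0 else coeff p (nat k))"

lemma int_coeff_add: "int_coeff (p + q) k = int_coeff p k + int_coeff q k"
  by (simp add: int_coeff_def)

lemma int_coeff_smult: "int_coeff (smult c p) k = c * int_coeff p k"
  by (simp add: int_coeff_def)

lemma int_coeff_pCons:
  "int_coeff (pCons c p) k = (if k = 0 then c else int_coeff p (k - 1))"
  by (auto simp: int_coeff_def coeff_pCons nat_diff_distrib split: nat.split)

lemma int_coeff_pderiv:
  "int_coeff (pderiv p) k = of_int (k + 1) * int_coeff p (k + 1)"
    for p :: "'a::idom poly"
proof (cases "k < 0")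
  case True
  \<comment> \<open>At k = -1 the factor k + 1 vanishes, although \<open>int_coeff p 0\<close> need
    not.\<close>
  then show ?thesis by (cases "k = -1") (simp_all add: int_coeff_def)
next
  case False
  then show ?thesis by (simp add: int_coeff_def coeff_pderiv nat_add_distrib)
qed

text \<open>As a rewrite rule it peels an explicit factor off one coefficient at a time, turning the
  product into a sum of index shifts.\<close>

lemma int_coeff_mult_pCons:
  "int_coeff (pCons c p * q) k = c * int_coeff q k + int_coeff (p * q) (k - 1)"
    for p :: "'a::comm_semiring_0 poly"
  by (simp add: int_coeff_add int_coeff_smult int_coeff_pCons) (simp add: int_coeff_def)

lemma int_coeff_0: "int_coeff 0 k = 0"
  by (simp add: int_coeff_def)

theorem theorem4p9:
  fixes \<delta> :: nat and T :: "nat \<Rightarrow> real poly"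
  assumes delta_pos: "\<delta> > 0"
    and T_init: "T (\<delta> - 1) = 1"
    and T_step: "\<And>n. n \<ge> \<delta> - 1 \<Longrightarrow>
      T (n + 1) =
        [: 1 + (real n - real \<delta> + 1) / real \<delta>, 1, (real n - real \<delta> + 1) / real \<delta> :] * T n
        + smult (1 / real \<delta>) ([: 1, -1, 1, -1 :] * pderiv (T n))"
  shows "(\<forall>n \<ge> \<delta> - 1. degree (T n) = n + 1 - \<delta>) \<and> (\<forall>n \<ge> \<delta> + 2. unimodal (T n))"
proof -
  \<comment> \<open>The shift makes N the degree; the natural subtraction is exact because \<delta>
    > 0.\<close>
  define a where "a N = int_coeff (T (N + \<delta> - 1))" for N
  interpret palindromic_recurrence \<delta> a
  proof
    show "\<delta> > 0" by (fact delta_pos)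
    show "a 0 k = (if k = 0 then 1 else 0)" for k
      by (auto simp: a_def T_init[simplified] int_coeff_def)
    show "a N k = 0" if "k < 0" for N k using that by (simp add: a_def int_coeff_def)
    show "real \<delta> * a (Suc N) k =
      (real N - k + 2) * a N (k - 2) + (real \<delta> + k - 1) * a N (k - 1)
      + (real \<delta> + real N - k) * a N k + (k + 1) * a N (k + 1)" for N k
    proof -
      define n where "n = N + \<delta> - 1"
      have n: "real n - real \<delta> + 1 = real N" "n \<ge> \<delta> - 1" "Suc N + \<delta> - 1 = n + 1"
        using delta_pos by (auto simp: n_def of_nat_diff)
      \<comment> \<open>With the reciprocal named, the recurrence follows from the polynomial
        relation \<delta> c = 1 without division.\<close>
      define c where "c = 1 / real \<delta>"
      have c: "real \<delta> * c = 1" using delta_pos by (simp add: c_def)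
      have "a (Suc N) k = (1 + real N * c) * a N k + a N (k - 1) + real N * c * a N (k - 2)
        + c * ((k + 1) * a N (k + 1) - k * a N k + (k - 1) * a N (k - 1) - (k - 2) * a N (k - 2))"
        unfolding a_def n(3) T_step[OF n(2)] n(1)
        by (simp only: int_coeff_add int_coeff_smult int_coeff_mult_pCons int_coeff_pderiv
            int_coeff_0 n_def mult_zero_left) (simp add: c_def)
      then show ?thesis using c of_int_add[of k 1] by simp algebra
    qed
  qed
  have co: "coeff (T n) k = a (n + 1 - \<delta>) (int k)" if "n \<ge> \<delta> - 1" for n k
    using that delta_pos by (simp add: a_def int_coeff_def)
  \<comment> \<open>The bound n \<ge> \<delta> + 2 is N \<ge> 3 for N = n + 1 - \<delta>.\<close>
  show ?thesis
    using degree_coeff_eq[OF co] unimodal_coeff_eq[OF co] by simp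
qed

end
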